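(* Let $0<q<p\le1$, $k\in\mathbb{Z}$ and $n\ge1$. Then $$B_{n,p,q}^{(k)}(x)=\sum_{m=0}^n\frac{(-1)^{m+n}m!}{[m+1]^k_{p,q}}S_2(n,m,x).$$
   Context: $[n]_{p,q}=\frac{p^n-q^n}{p-q}$; $\mathrm{Li}_{k,p,q}(t)=\sum_{n\ge1} t^n/[n]_{p,q}^k$. The $(p,q)$-poly-Bernoulli polynomials are defined by $\frac{\mathrm{Li}_{k,p,q}(1-e^{-t})}{1-e^{-t}}e^{-xt}=\sum_{n\ge0}B_{n,p,q}^{(k)}(x)\frac{t^n}{n!}$. The weighted Stirling numbers of the second kind are defined by $\frac{e^{xt}(e^t-1)^m}{m!}=\sum_{n\ge m}S_2(n,m,x)\frac{t^n}{n!}$. *)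

theory Defs
  imports Complex_Main "HOL-Computational_Algebra.Formal_Power_Series"
begin

text \<open>
  The generating functions are formal power series in \<open>t\<close>. The parameters \<open>p\<close>, \<open>q\<close> are real;
  the argument \<open>x\<close> of the polynomials ranges over any real field, in particular over
  the real and the complex numbers.
\<close>

definition pq_number :: "real \<Rightarrow> real \<Rightarrow> nat \<Rightarrow> real" where
  "pq_number p q n = (p ^ n - q ^ n) / (p - q)"

definition pq_polylog :: "int \<Rightarrow> real \<Rightarrow> real \<Rightarrow> 'a::real_field fps" where
  "pq_polylog k p q =
     Abs_fps (\<lambda>n. if n = 0 then 0 else of_real (1 / pq_number p q n powi k))"

text \<open>
  The composition and the quotient are the genuine ones: \<open>1 - e\<^sup>-\<^sup>t\<close> has constant term \<open>0\<close>, and it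
  divides its composite with the polylogarithm
  (lemma \<open>pq_polylog_compose_divide\<close> below).
\<close>

definition pq_poly_bernoulli_gf :: "int \<Rightarrow> real \<Rightarrow> real \<Rightarrow> 'a::real_field \<Rightarrow> 'a fps" where
  "pq_poly_bernoulli_gf k p q x =
     (pq_polylog k p q oo (1 - fps_exp (-1))) / (1 - fps_exp (-1)) * fps_exp (- x)"

definition pq_poly_bernoulli :: "nat \<Rightarrow> int \<Rightarrow> real \<Rightarrow> real \<Rightarrow> 'a::real_field \<Rightarrow> 'a" where
  "pq_poly_bernoulli n k p q x = fact n * fps_nth (pq_poly_bernoulli_gf k p q x) n"

definition weighted_stirling2_gf :: "nat \<Rightarrow> 'a::real_field \<Rightarrow> 'a fps" where
  "weighted_stirling2_gf m x =
     fps_const (1 / fact m) * (fps_exp x * (fps_exp 1 - 1) ^ m)"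

definition weighted_stirling2 :: "nat \<Rightarrow> nat \<Rightarrow> 'a::real_field \<Rightarrow> 'a" where
  "weighted_stirling2 n m x = fact n * fps_nth (weighted_stirling2_gf m x) n"

lemma pq_poly_bernoulli_gf_eq:
  "pq_poly_bernoulli_gf k p q x = Abs_fps (\<lambda>n. pq_poly_bernoulli n k p q x / fact n)"
  by (rule fps_ext) (simp add: pq_poly_bernoulli_def)

lemma weighted_stirling2_eq_0:
  fixes x :: "'a::real_field"
  assumes "n < m"
  shows "weighted_stirling2 n m x = 0"
proof -
  have "fps_nth ((fps_exp 1 - 1 :: 'a fps) ^ m) i = 0" if "i < m" for i
    by (rule startsby_zero_power_prefix[rule_format]) (use that in auto)
  with assms have "fps_nth (fps_exp x * (fps_exp 1 - 1) ^ m) n = 0"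
    by (simp add: fps_mult_nth)
  then show ?thesis
    by (simp add: weighted_stirling2_def weighted_stirling2_gf_def)
qed

lemma weighted_stirling2_gf_eq:
  "weighted_stirling2_gf m x =
     Abs_fps (\<lambda>n. if n \<ge> m then weighted_stirling2 n m x / fact n else 0)"
proof (rule fps_ext)
  fix n
  show "fps_nth (weighted_stirling2_gf m x) n =
    fps_nth (Abs_fps (\<lambda>n. if n \<ge> m then weighted_stirling2 n m x / fact n else 0)) n"
    using weighted_stirling2_eq_0[of n m x]
    by (auto simp: weighted_stirling2_def)
qed

lemma pq_polylog_compose_divide:
  "(1 - fps_exp (-1)) * ((pq_polylog k p q oo (1 - fps_exp (-1))) / (1 - fps_exp (-1))) =
   (pq_polylog k p q oo (1 - fps_exp (-1)) :: 'a::real_field fps)"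
proof -
  let ?u = "1 - fps_exp (-1) :: 'a fps"
  let ?L = "pq_polylog k p q :: 'a fps"
  have "?L = fps_X * fps_shift 1 ?L"
    by (rule fps_ext) (auto simp: pq_polylog_def)
  then have "?L oo ?u = (fps_X * fps_shift 1 ?L) oo ?u"
    by simp
  also have "\<dots> = ?u * (fps_shift 1 ?L oo ?u)"
    by (subst fps_compose_mult_distrib) simp_all
  finally have "?u dvd ?L oo ?u" by simp
  then show ?thesis by simp
qed

end

theory Submission imports Defs begin

text \<open>
  Dividing the polylogarithm by its argument shifts its coefficients, so with \<open>u = 1 - e\<^sup>-\<^sup>t\<close> the
  generating function of the poly-Bernoulli polynomials is \<open>\<Sum>m. u\<^sup>m e\<^sup>-\<^sup>x\<^sup>t / [m+1]\<^sup>k\<close>. The series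
  \<open>u\<^sup>m e\<^sup>-\<^sup>x\<^sup>t\<close> arises from \<open>(-1)\<^sup>m (e\<^sup>t - 1)\<^sup>m e\<^sup>x\<^sup>t\<close> by the substitution \<open>t \<mapsto> -t\<close>, and its
  coefficients are therefore signed multiples of the weighted Stirling numbers.
\<close>

text \<open>Since \<open>g ^ m\<close> has no terms of degree below \<open>m\<close>, the sum for
  each coefficient of \<open>f oo g\<close> up to degree \<open>n\<close> can run over the same
  range \<open>0..n\<close>; the two finite sums then swap.\<close>

lemma fps_compose_mult_nth:
  fixes f g h :: "'a::comm_ring_1 fps"
  assumes "fps_nth g 0 = 0"
  shows "fps_nth ((f oo g) * h) n = (\<Sum>m = 0..n. fps_nth f m * fps_nth (g ^ m * h) n)"
proof -
  have compose: "fps_nth (f oo g) i = (\<Sum>m = 0..n. fps_nth f m * fps_nth (g ^ m) i)"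
    if "i \<le> n" for i
    unfolding fps_compose_nth
    by (rule sum.mono_neutral_left)
       (use that assms in \<open>auto simp: startsby_zero_power_prefix\<close>)
  have "fps_nth ((f oo g) * h) n =
      (\<Sum>i = 0..n. \<Sum>m = 0..n. fps_nth f m * fps_nth (g ^ m) i * fps_nth h (n - i))"
    by (simp add: fps_mult_nth compose sum_distrib_right)
  also have "\<dots> = (\<Sum>m = 0..n. \<Sum>i = 0..n. fps_nth f m * fps_nth (g ^ m) i * fps_nth h (n - i))"
    by (rule sum.swap)
  finally show ?thesis
    by (simp add: fps_mult_nth sum_distrib_left mult.assoc)
qed

lemma pq_polylog_compose_divide_eq:
  "(pq_polylog k p q oo (1 - fps_exp (-1))) / (1 - fps_exp (-1)) =
   (fps_shift 1 (pq_polylog k p q) oo (1 - fps_exp (-1)) :: 'a::real_field fps)"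
proof -
  let ?u = "1 - fps_exp (-1) :: 'a fps"
  let ?L = "pq_polylog k p q :: 'a fps"
  have "fps_nth ?u 1 \<noteq> 0"
    by simp
  then have "?u \<noteq> 0"
    by (metis fps_zero_nth)
  \<comment> \<open>The constant term of \<open>?L\<close> is 0, so a factor \<open>fps_X\<close>
    splits off; composition turns it into \<open>?u\<close>, which cancels.\<close>
  have "?L = fps_X * fps_shift 1 ?L"
    by (rule fps_ext) (auto simp: pq_polylog_def)
  then have "?L oo ?u = (fps_X * fps_shift 1 ?L) oo ?u"
    by simp
  also have "\<dots> = ?u * (fps_shift 1 ?L oo ?u)"
    by (subst fps_compose_mult_distrib) simp_all
  finally show ?thesis
    using \<open>?u \<noteq> 0\<close> by simp
qed

lemma weighted_stirling2_compose_uminus: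
  fixes x :: "'a::real_field"
  shows "fact n * fps_nth ((1 - fps_exp (-1)) ^ m * fps_exp (- x)) n =
    (-1) ^ (m + n) * fact m * weighted_stirling2 n m x"
proof -
  let ?g = "fps_exp x * (fps_exp 1 - 1) ^ m :: 'a fps"
  have "?g oo - fps_X = fps_exp (- x) * (fps_exp (-1) - 1) ^ m"
    by (simp add: fps_compose_mult_distrib fps_compose_sub_distrib
        flip: fps_compose_power)
  also have "(fps_exp (-1) - 1 :: 'a fps) ^ m = (-1) ^ m * (1 - fps_exp (-1)) ^ m"
    by (simp flip: power_mult_distrib)
  finally have "(1 - fps_exp (-1)) ^ m * fps_exp (- x) = fps_const ((-1) ^ m) * (?g oo - fps_X)"
    by (simp add: mult_ac flip: fps_const_power fps_const_neg power_mult_distrib)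
  \<comment> \<open>\<open>(-1) ^ m\<close> comes from reversing \<open>fps_exp (-1) - 1\<close>,
    \<open>(-1) ^ n\<close> from replacing t by -t.\<close>
  then have "fps_nth ((1 - fps_exp (-1)) ^ m * fps_exp (- x)) n =
      (-1) ^ (m + n) * fps_nth ?g n"
    by (simp add: fps_compose_uminus' power_add)
  then show ?thesis
    by (simp add: weighted_stirling2_def weighted_stirling2_gf_def)
qed

theorem theorem9:
  fixes p q :: real and k :: int and n :: nat and x :: "'a::real_field"
  assumes "0 < q" and "q < p" and "p \<le> 1" and "n \<ge> 1"
  shows "pq_poly_bernoulli n k p q x =
    (\<Sum>m = 0..n. (-1) ^ (m + n) * fact m / of_real (pq_number p q (m + 1) powi k)
       * weighted_stirling2 n m x)"
proof -
  let ?u = "1 - fps_exp (-1) :: 'a fps"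
  have "pq_poly_bernoulli n k p q x =
      (\<Sum>m = 0..n. of_real (1 / pq_number p q (m + 1) powi k) *
        (fact n * fps_nth (?u ^ m * fps_exp (- x)) n))"
    \<comment> \<open>The shift produces the index \<open>m + 1\<close>, so the zero coefficient of
      \<open>pq_polylog\<close> never enters.\<close>
    unfolding pq_poly_bernoulli_def pq_poly_bernoulli_gf_def pq_polylog_compose_divide_eq
    by (subst fps_compose_mult_nth)
       (simp_all add: pq_polylog_def sum_distrib_left mult_ac)
  then show ?thesis
    unfolding weighted_stirling2_compose_uminus by (simp add: mult_ac)
qed

end
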